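(* Let $p,q\ge 1$ and $1\le r\le p$ be integers. Every non-minimal linear self map of $D^r_{p,q}$ can be represented by a matrix $M\in M_{p+q}$ satisfying $$M^H H_{p,q} M - H_{p,q}\ \ge\ 0,$$ where $\ge 0$ means Hermitian positive semi-definiteness.
   Context: $M_n$ is the set of $n\times n$ complex matrices and $\cdot^H$ is the Hermitian (conjugate) transpose. $H_{p,q}=\begin{pmatrix}I_p&0\\0&-I_q\end{pmatrix}$ is the standard Hermitian form of signature $(p,q)$ on $\mathbb C^{p+q}$; $\mathbb C^{p,q}$ denotes $\mathbb C^{p+q}$ equipped with $H_{p,q}$. For $1\le r\le p$, the generalized type-I domain $D^r_{p,q}\subset Gr(r,\mathbb C^{p+q})$ is the set of $r$-dimensional complex linear subspaces ($r$-planes) of $\mathbb C^{p+q}$ on which $H_{p,q}$ is positive definite. A matrix $M\in M_{p+q}$ acts on column vectors by $z\mapsto Mz$. If the kernel of $M$ is negative semi-definite with respect to $H_{p,q}$ (equivalently, $M$ maps every positive definite $r$-plane onto an $r$-plane), $M$ induces a holomorphic map $D^r_{p,q}\to Gr(r,\mathbb C^{p+q})$, $P\mapsto M(P)$. A self map of $D^r_{p,q}$ is called a linear self map if it is induced in this way by some $M\in M_{p+q}$; any such $M$ is called a matrix representation of the linear self map (and is said to represent it). A linear self map of $D^r_{p,q}$ is called minimal if it is given by a matrix of rank $p$, and non-minimal otherwise (every matrix representation has rank at least $p$). *)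

theory Defs
  imports "HOL-Analysis.Analysis"
begin

(* C^(p+q) is the type complex ^ ('p + 'q), where p = CARD('p) and q = CARD('q) are
   automatically at least 1.  Subspaces, dimension and rank are the complex ones
   (vec.subspace, vec.dim, rank), not the real ones. *)

definition conj_transpose :: "complex^'n^'m \<Rightarrow> complex^'m^'n"  (\<open>(_\<^sup>H)\<close> [1000] 999)
  where "A\<^sup>H = (\<chi> i j. cnj (A $ j $ i))"

definition hermitian :: "complex^'n^'n \<Rightarrow> bool"
  where "hermitian A \<longleftrightarrow> A\<^sup>H = A"

definition sesq_form :: "complex^'n^'n \<Rightarrow> complex^'n \<Rightarrow> complex^'n \<Rightarrow> complex"
  where "sesq_form A z w = (\<Sum>i\<in>UNIV. cnj (z $ i) * (A *v w) $ i)"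

(* The value z^H A z is real when A is hermitian, so that in the definitions below
   taking the real part loses nothing. *)
lemma sesq_form_self_real:
  assumes "hermitian A"
  shows "sesq_form A z z \<in> \<real>"
proof -
  have A: "cnj (A $ i $ j) = A $ j $ i" for i j
    using assms by (auto simp: hermitian_def conj_transpose_def vec_eq_iff)
  have "cnj (sesq_form A z z) = (\<Sum>i\<in>UNIV. \<Sum>j\<in>UNIV. z $ i * (A $ j $ i * cnj (z $ j)))"
    by (simp add: sesq_form_def matrix_vector_mult_def A sum_distrib_left)
  also have "\<dots> = (\<Sum>j\<in>UNIV. \<Sum>i\<in>UNIV. z $ i * (A $ j $ i * cnj (z $ j)))"
    by (rule sum.swap)
  also have "\<dots> = sesq_form A z z"
    by (simp add: sesq_form_def matrix_vector_mult_def sum_distrib_left mult_ac)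
  finally show ?thesis
    by (simp add: Reals_cnj_iff)
qed

definition pos_semidef :: "complex^'n^'n \<Rightarrow> bool"
  where "pos_semidef A \<longleftrightarrow> hermitian A \<and> (\<forall>z. 0 \<le> Re (sesq_form A z z))"

definition pos_def_on :: "complex^'n^'n \<Rightarrow> (complex^'n) set \<Rightarrow> bool"
  where "pos_def_on A S \<longleftrightarrow> (\<forall>z\<in>S. z \<noteq> 0 \<longrightarrow> 0 < Re (sesq_form A z z))"

definition neg_semidef_on :: "complex^'n^'n \<Rightarrow> (complex^'n) set \<Rightarrow> bool"
  where "neg_semidef_on A S \<longleftrightarrow> (\<forall>z\<in>S. Re (sesq_form A z z) \<le> 0)"

definition Hpq :: "complex^('p::finite + 'q::finite)^('p + 'q)"
  where "Hpq = (\<chi> i j. if i = j then (case i of Inl _ \<Rightarrow> 1 | Inr _ \<Rightarrow> - 1) else 0)"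

lemma hermitian_Hpq: "hermitian Hpq"
  by (auto simp: hermitian_def conj_transpose_def Hpq_def vec_eq_iff split: sum.split)

definition typeI_domain :: "nat \<Rightarrow> (complex^('p::finite + 'q::finite)) set set"
  where "typeI_domain r = {P. vec.subspace P \<and> vec.dim P = r \<and> pos_def_on Hpq P}"

(* A self map of the domain is a total function on sets of vectors that maps the domain to
   itself; its values outside the domain are irrelevant. *)
definition represents ::
    "nat \<Rightarrow> complex^('p::finite + 'q::finite)^('p + 'q)
      \<Rightarrow> ((complex^('p + 'q)) set \<Rightarrow> (complex^('p + 'q)) set) \<Rightarrow> bool"
  where "represents r M F \<longleftrightarrow>
    neg_semidef_on Hpq {z. M *v z = 0} \<and> (\<forall>P\<in>typeI_domain r. F P = (*v) M ` P)"

definition linear_self_map ::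
    "nat \<Rightarrow> ((complex^('p::finite + 'q::finite)) set \<Rightarrow> (complex^('p + 'q)) set) \<Rightarrow> bool"
  where "linear_self_map r F \<longleftrightarrow>
    F \<in> typeI_domain r \<rightarrow> typeI_domain r \<and> (\<exists>M. represents r M F)"

definition minimal_self_map ::
    "nat \<Rightarrow> ((complex^('p::finite + 'q::finite)) set \<Rightarrow> (complex^('p + 'q)) set) \<Rightarrow> bool"
  where "minimal_self_map r F \<longleftrightarrow>
    linear_self_map r F \<and> (\<exists>M. represents r M F \<and> rank M = CARD('p))"

end

theory Submission
  imports Defs
begin

text \<open>
  Since \<open>r \<le> p\<close>, every positive vector lies in a positive definite \<open>r\<close>-plane, so a matrix \<open>M\<close>
  representing the map sends positive vectors to positive vectors. By the Hermitian S-lemma there is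
  \<open>c \<ge> 0\<close> with \<open>M\<^sup>H H M - c H \<ge> 0\<close>. If \<open>c > 0\<close>, the matrix \<open>M / sqrt c\<close> induces the same map and has
  the required property. If \<open>c = 0\<close>, the range of \<open>M\<close> is positive semi-definite, hence of dimension
  at most \<open>p\<close>; as the kernel is negative semi-definite, the rank is exactly \<open>p\<close> and the map
  is minimal.
\<close>

section \<open>Hermitian forms\<close>

lemma sesq_form_add_left: "sesq_form A (x + y) w = sesq_form A x w + sesq_form A y w"
  by (simp add: sesq_form_def algebra_simps sum.distrib)

lemma sesq_form_add_right: "sesq_form A w (x + y) = sesq_form A w x + sesq_form A w y"
  by (simp add: sesq_form_def algebra_simps sum.distrib)

lemma sesq_form_scale_left: "sesq_form A (c *s x) w = cnj c * sesq_form A x w"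
  by (simp add: sesq_form_def sum_distrib_left algebra_simps)

lemma sesq_form_scale_right: "sesq_form A w (c *s x) = c * sesq_form A w x"
  by (simp add: sesq_form_def sum_distrib_left vector_scalar_commute algebra_simps)

lemma sesq_form_scale_self:
  "Re (sesq_form A (c *s x) (c *s x)) = (cmod c)\<^sup>2 * Re (sesq_form A x x)"
proof -
  have "sesq_form A (c *s x) (c *s x) = (c * cnj c) * sesq_form A x x"
    by (simp add: sesq_form_scale_left sesq_form_scale_right)
  also have "c * cnj c = of_real ((cmod c)\<^sup>2)"
    by (metis complex_norm_square)
  finally show ?thesis
    by simp
qed

lemma sesq_form_diff_matrix: "sesq_form (A - B) x y = sesq_form A x y - sesq_form B x y"
  by (simp add: sesq_form_def algebra_simps sum_subtractf)

lemma sesq_form_conj_transpose: "sesq_form (A\<^sup>H) x y = cnj (sesq_form A y x)"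
proof -
  have "sesq_form (A\<^sup>H) x y = (\<Sum>i\<in>UNIV. \<Sum>j\<in>UNIV. cnj (x $ i) * (cnj (A $ j $ i) * y $ j))"
    by (simp add: sesq_form_def matrix_vector_mult_def conj_transpose_def sum_distrib_left)
  also have "\<dots> = (\<Sum>j\<in>UNIV. \<Sum>i\<in>UNIV. cnj (x $ i) * (cnj (A $ j $ i) * y $ j))"
    by (rule sum.swap)
  also have "\<dots> = cnj (sesq_form A y x)"
    by (simp add: sesq_form_def matrix_vector_mult_def sum_distrib_left mult_ac)
  finally show ?thesis .
qed

lemma conj_transpose_adjoint:
  "(\<Sum>i\<in>UNIV. cnj (x $ i) * ((M\<^sup>H) *v y) $ i) = (\<Sum>j\<in>UNIV. cnj ((M *v x) $ j) * y $ j)"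
proof -
  have "(\<Sum>i\<in>UNIV. cnj (x $ i) * ((M\<^sup>H) *v y) $ i)
      = (\<Sum>i\<in>UNIV. \<Sum>j\<in>UNIV. cnj (x $ i) * (cnj (M $ j $ i) * y $ j))"
    by (simp add: matrix_vector_mult_def conj_transpose_def sum_distrib_left)
  also have "\<dots> = (\<Sum>j\<in>UNIV. \<Sum>i\<in>UNIV. cnj (x $ i) * (cnj (M $ j $ i) * y $ j))"
    by (rule sum.swap)
  also have "\<dots> = (\<Sum>j\<in>UNIV. cnj ((M *v x) $ j) * y $ j)"
    by (simp add: matrix_vector_mult_def sum_distrib_left sum_distrib_right mult_ac)
  finally show ?thesis .
qed

lemma sesq_form_congruence:
  "sesq_form (M\<^sup>H ** A ** M) x y = sesq_form A (M *v x) (M *v y)"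
  using conj_transpose_adjoint[of x M "A *v (M *v y)"]
  by (simp add: sesq_form_def matrix_vector_mul_assoc matrix_mul_assoc)

lemma conj_transpose_mult: "(A ** B)\<^sup>H = B\<^sup>H ** A\<^sup>H"
  by (simp add: vec_eq_iff conj_transpose_def matrix_matrix_mult_def mult.commute)

lemma conj_transpose_conj_transpose [simp]: "(A\<^sup>H)\<^sup>H = A"
  by (simp add: vec_eq_iff conj_transpose_def)

lemma hermitian_congruence: "hermitian A \<Longrightarrow> hermitian (M\<^sup>H ** A ** M)"
  by (simp add: hermitian_def conj_transpose_mult matrix_mul_assoc)

lemma hermitian_diff: "hermitian A \<Longrightarrow> hermitian B \<Longrightarrow> hermitian (A - B)"
  by (simp add: hermitian_def conj_transpose_def vec_eq_iff)

section \<open>The S-lemma for two Hermitian forms\<close>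

lemma sesq_form_self_add:
  assumes "hermitian A"
  shows "Re (sesq_form A (x + d *s y) (x + d *s y)) =
    Re (sesq_form A x x) + (cmod d)\<^sup>2 * Re (sesq_form A y y) + 2 * Re (d * sesq_form A x y)"
proof -
  have "sesq_form A y x = cnj (sesq_form A x y)"
    using assms sesq_form_conj_transpose[of A y x] by (simp add: hermitian_def)
  then have "Re (sesq_form A (d *s y) x) = Re (d * sesq_form A x y)"
    by (simp add: sesq_form_scale_left)
  moreover have "Re (sesq_form A x (d *s y)) = Re (d * sesq_form A x y)"
    by (simp add: sesq_form_scale_right)
  ultimately show ?thesis
    using sesq_form_scale_self[of A d y]
    by (simp add: sesq_form_add_left sesq_form_add_right)
qed

text \<open>Perturbation towards \<open>e\<close>: with the sign \<open>s\<close> chosen so that the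
  cross term of \<open>A\<close> is nonnegative, \<open>z + t s e\<close> is
  \<open>A\<close>-positive for every \<open>t > 0\<close>. Hence \<open>B\<close> is nonnegative
  there, and letting \<open>t\<close> decrease to 0 gives the claim at \<open>z\<close>.\<close>

lemma hermitian_nonneg_on_isotropic:
  assumes A: "hermitian A" and B: "hermitian B"
    and e: "0 < Re (sesq_form A e e)"
    and pos: "\<And>z. 0 < Re (sesq_form A z z) \<Longrightarrow> 0 \<le> Re (sesq_form B z z)"
    and z: "Re (sesq_form A z z) = 0"
  shows "0 \<le> Re (sesq_form B z z)"
proof -
  obtain s :: real where s: "\<bar>s\<bar> = 1" "0 \<le> s * Re (sesq_form A z e)"
  proof (cases "0 \<le> Re (sesq_form A z e)")
    case True
    then show ?thesis using that[of 1] by simp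
  next
    case False
    then show ?thesis using that[of "-1"] by simp
  qed
  have nonneg: "0 \<le> Re (sesq_form B z z) + t\<^sup>2 * Re (sesq_form B e e)
      + 2 * (t * s * Re (sesq_form B z e))" if "0 < t" for t :: real
  proof -
    have cm: "(cmod (of_real (t * s)))\<^sup>2 = t\<^sup>2"
      using s(1) \<open>0 < t\<close> by (simp add: norm_mult power_mult_distrib)
    have "0 \<le> t * (s * Re (sesq_form A z e))"
      using s(2) \<open>0 < t\<close> by simp
    moreover have "0 < t\<^sup>2 * Re (sesq_form A e e)"
      using e \<open>0 < t\<close> by simp
    ultimately have "0 < Re (sesq_form A (z + of_real (t * s) *s e) (z + of_real (t * s) *s e))"
      unfolding sesq_form_self_add[OF A] cm using z by (simp add: mult.assoc)
    from pos[OF this] show ?thesis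
      unfolding sesq_form_self_add[OF B] cm by simp
  qed
  have "((\<lambda>t. Re (sesq_form B z z) + t\<^sup>2 * Re (sesq_form B e e)
      + 2 * (t * s * Re (sesq_form B z e))) \<longlongrightarrow>
      Re (sesq_form B z z) + 0\<^sup>2 * Re (sesq_form B e e) + 2 * (0 * s * Re (sesq_form B z e)))
      (at_right 0)"
    by (intro tendsto_intros)
  moreover have "\<forall>\<^sub>F t in at_right (0::real). 0 \<le> Re (sesq_form B z z)
      + t\<^sup>2 * Re (sesq_form B e e) + 2 * (t * s * Re (sesq_form B z e))"
    using nonneg by (auto intro: eventually_at_rightI[of 0 1])
  ultimately show ?thesis
    using tendsto_lowerbound[of _ _ "at_right (0::real)" 0] by fastforce
qed

text \<open>Leaves room for a common multiplier: quotients at \<open>A\<close>-positive vectors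
  bound it from above, those at \<open>A\<close>-negative vectors from below. The idea is to combine
  \<open>x\<close> with multiples of \<open>y\<close> so as to land on the isotropic cone of
  \<open>A\<close>, where \<open>B\<close> is already known to be nonnegative.\<close>

lemma hermitian_ratio_mono:
  assumes A: "hermitian A" and B: "hermitian B"
    and pos: "\<And>z. 0 < Re (sesq_form A z z) \<Longrightarrow> 0 \<le> Re (sesq_form B z z)"
    and x: "0 < Re (sesq_form A x x)" and y: "Re (sesq_form A y y) < 0"
  shows "Re (sesq_form B y y) / Re (sesq_form A y y) \<le> Re (sesq_form B x x) / Re (sesq_form A x x)"
proof -
  define h where "h = sesq_form A x y"
  \<comment> \<open>This modulus balances the diagonal terms of \<open>A\<close> at \<open>x\<close>
    and \<open>t y\<close>. In \<open>d\<close> the case \<open>h = 0\<close> is separate because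
    \<open>sgn 0 = 0\<close> would make \<open>d\<close> vanish, while \<open>cmod d = t\<close> is
    needed.\<close>
  define t where "t = sqrt (Re (sesq_form A x x) / - Re (sesq_form A y y))"
  define d where "d = of_real t * (if h = 0 then 1 else \<i> * cnj (sgn h))"
  have t2: "t\<^sup>2 = Re (sesq_form A x x) / - Re (sesq_form A y y)"
    unfolding t_def using x y by (simp add: divide_pos_neg less_imp_le)
  have d: "(cmod d)\<^sup>2 = t\<^sup>2"
    by (auto simp: d_def norm_mult norm_sgn power_mult_distrib)
  have "cnj (sgn h) * h = h * cnj h / of_real (cmod h)"
    by (simp add: sgn_eq)
  also have "\<dots> = of_real ((cmod h)\<^sup>2 / cmod h)"
    by (simp only: complex_norm_square of_real_divide)
  finally have "cnj (sgn h) * h = of_real (cmod h)"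
    by (simp add: power2_eq_square)
  then have "\<i> * cnj (sgn h) * h = \<i> * of_real (cmod h)"
    by (simp add: mult.assoc)
  then have dh: "Re (d * h) = 0"
    by (simp add: d_def mult.assoc)
  \<comment> \<open>The phase of \<open>d\<close> makes both \<open>x + d y\<close> and \<open>x - d y\<close> isotropic for \<open>A\<close>; adding the
    two values of \<open>B\<close> cancels its cross term.\<close>
  have iso: "Re (sesq_form A (x + k *s y) (x + k *s y)) = 0" if "k = d \<or> k = - d" for k
  proof -
    have "(cmod k)\<^sup>2 = t\<^sup>2" and "Re (k * h) = 0"
      using that d dh by auto
    then show ?thesis
      unfolding sesq_form_self_add[OF A] h_def[symmetric] using y by (simp add: t2)
  qed
  have "0 \<le> Re (sesq_form B (x + k *s y) (x + k *s y))" if "k = d \<or> k = - d" for k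
    using hermitian_nonneg_on_isotropic[OF A B x pos iso[OF that]] .
  from this[of d] this[of "- d"] have "0 \<le> Re (sesq_form B x x) + t\<^sup>2 * Re (sesq_form B y y)"
    unfolding sesq_form_self_add[OF B] by (simp add: d)
  then show ?thesis
    unfolding t2 using x y by (simp add: field_simps)
qed

text \<open>The multiplier is the infimum of the quotients \<open>B / A\<close> over
  \<open>A\<close>-positive vectors. At \<open>A\<close>-negative vectors
  \<open>hermitian_ratio_mono\<close> puts the quotient below this infimum, and multiplying by the
  negative value of \<open>A\<close> reverses the inequality; at isotropic vectors the multiplier
  drops out.\<close>

lemma hermitian_S_lemma:
  assumes A: "hermitian A" and B: "hermitian B"
    and e: "0 < Re (sesq_form A e e)"
    and pos: "\<And>z. 0 < Re (sesq_form A z z) \<Longrightarrow> 0 \<le> Re (sesq_form B z z)"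
  obtains c where "0 \<le> c" "\<And>z. c * Re (sesq_form A z z) \<le> Re (sesq_form B z z)"
proof -
  define R where "R = (\<lambda>x. Re (sesq_form B x x) / Re (sesq_form A x x)) ` {x. 0 < Re (sesq_form A x x)}"
  have "R \<noteq> {}"
    using e by (auto simp: R_def)
  have lower: "0 \<le> u" if "u \<in> R" for u
    using that pos by (auto simp: R_def)
  then have "bdd_below R"
    by (rule bdd_belowI)
  have "Inf R * Re (sesq_form A z z) \<le> Re (sesq_form B z z)" for z
  proof (cases "Re (sesq_form A z z)" "0::real" rule: linorder_cases)
    case less
    have "Re (sesq_form B z z) / Re (sesq_form A z z) \<le> u" if "u \<in> R" for u
      using that hermitian_ratio_mono[OF A B pos _ less] by (auto simp: R_def)
    then have "Re (sesq_form B z z) / Re (sesq_form A z z) \<le> Inf R"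
      using cInf_greatest[OF \<open>R \<noteq> {}\<close>] by blast
    then show ?thesis
      using less by (simp add: field_simps)
  next
    case equal
    then show ?thesis
      using hermitian_nonneg_on_isotropic[OF A B e pos] by simp
  next
    case greater
    then have "Inf R \<le> Re (sesq_form B z z) / Re (sesq_form A z z)"
      using cInf_lower[OF _ \<open>bdd_below R\<close>] by (auto simp: R_def)
    then show ?thesis
      using greater by (simp add: field_simps)
  qed
  moreover have "0 \<le> Inf R"
    using cInf_greatest[OF \<open>R \<noteq> {}\<close>] lower by blast
  ultimately show ?thesis
    using that by blast
qed

section \<open>Row rank and column rank over a field\<close>

text \<open>Expanding the columns in a basis \<open>B\<close> of their span factors \<open>A\<close>
  through a space of dimension \<open>card B\<close>. Each row of \<open>A\<close> is then a
  combination of the coefficient vectors in \<open>?R\<close>, at most one for each member of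
  \<open>B\<close>.\<close>

lemma row_rank_le_column_rank:
  fixes A :: "'a::field^'n^'m"
  shows "vec.dim (rows A) \<le> vec.dim (columns A)"
proof -
  obtain B where B: "B \<subseteq> columns A" "vec.independent B" "columns A \<subseteq> vec.span B"
      "card B = vec.dim (columns A)"
    by (rule vec.basis_exists)
  have finB: "finite B"
    using B(2) vec.finiteI_independent by blast
  have "\<exists>c. \<forall>j. column j A = (\<Sum>b\<in>B. c j b *s b)"
  proof (rule choice, intro allI)
    fix j
    have "column j A \<in> vec.span B"
      using B(3) by (auto simp: columns_def)
    then show "\<exists>u. column j A = (\<Sum>b\<in>B. u b *s b)"
      unfolding vec.span_finite[OF finB] by auto
  qed
  then obtain c where c: "\<And>j. column j A = (\<Sum>b\<in>B. c j b *s b)"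
    by blast
  let ?R = "(\<lambda>b. \<chi> j. c j b) ` B"
  have "row i A \<in> vec.span ?R" for i
  proof -
    have "A $ i $ j = (\<Sum>b\<in>B. c j b * b $ i)" for j
      using arg_cong[OF c[of j], of "\<lambda>v. v $ i"] by (simp add: column_def)
    then have "row i A = (\<Sum>b\<in>B. b $ i *s (\<chi> j. c j b))"
      by (simp add: vec_eq_iff row_def mult.commute)
    then show ?thesis
      by (simp add: vec.span_sum vec.span_scale vec.span_base)
  qed
  then have "rows A \<subseteq> vec.span ?R"
    by (auto simp: rows_def)
  then have "vec.dim (rows A) \<le> card ?R"
    using finB by (intro vec.dim_le_card) auto
  also have "\<dots> \<le> card B"
    using finB by (rule card_image_le)
  finally show ?thesis
    using B(4) by simp
qed

text \<open>\<open>rank\<close> is by definition the row rank. The previous inequality for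
  \<open>A\<close> and for its transpose turns it into the column rank, and the columns span the
  range.\<close>

lemma rank_eq_dim_range:
  fixes A :: "'a::field^'n^'m"
  shows "rank A = vec.dim (range ((*v) A))"
proof -
  have "rank A = vec.dim (columns A)"
    using row_rank_le_column_rank[of A] row_rank_le_column_rank[of "transpose A"]
    by (simp add: row_rank_def_gen)
  also have "vec.span (columns A) = range ((*v) A)"
  proof
    show "vec.span (columns A) \<subseteq> range ((*v) A)"
    proof (rule vec.span_minimal)
      have "column j A = A *v axis j 1" for j
        by (simp add: vec_eq_iff column_def matrix_vector_mult_def axis_def if_distrib cong: if_cong)
      then show "columns A \<subseteq> range ((*v) A)"
        by (auto simp: columns_def)
      show "vec.subspace (range ((*v) A))"
        using vec.subspace_image[OF vec.subspace_UNIV] .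
    qed
    show "range ((*v) A) \<subseteq> vec.span (columns A)"
    proof (rule image_subsetI)
      fix x
      show "A *v x \<in> vec.span (columns A)"
        unfolding matrix_mult_sum
        by (intro vec.span_sum vec.span_scale vec.span_base) (auto simp: columns_def)
    qed
  qed
  then have "vec.dim (columns A) = vec.dim (range ((*v) A))"
    by (metis vec.dim_span)
  finally show ?thesis .
qed

section \<open>The standard form of signature \<open>(p, q)\<close>\<close>

lemma sum_UNIV_sum_type:
  "(\<Sum>i\<in>(UNIV :: ('p::finite + 'q::finite) set). f i) = (\<Sum>k\<in>UNIV. f (Inl k)) + (\<Sum>l\<in>UNIV. f (Inr l))"
  unfolding UNIV_Plus_UNIV[symmetric] by (subst sum.Plus) (simp_all add: o_def)

lemma Re_sesq_form_Hpq:
  fixes z :: "complex^('p::finite + 'q::finite)"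
  shows "Re (sesq_form Hpq z z) =
    (\<Sum>k\<in>UNIV. (cmod (z $ Inl k))\<^sup>2) - (\<Sum>l\<in>UNIV. (cmod (z $ Inr l))\<^sup>2)"
proof -
  have "(Hpq *v z) $ i = (case i of Inl _ \<Rightarrow> 1 | Inr _ \<Rightarrow> - 1) * z $ i" for i
    by (simp add: matrix_vector_mult_def Hpq_def if_distrib[of "\<lambda>u. u * _"] cong: if_cong)
  then show ?thesis
    unfolding sesq_form_def sum_UNIV_sum_type
    by (simp add: cmod_power2 sum_negf) (simp add: power2_eq_square)
qed

text \<open>Parametrises the \<open>p\<close>-planes that are graphs over the positive coordinates.
  For \<open>L = 0\<close> it is the coordinate embedding, whose image is positive definite.\<close>

definition graph_matrix :: "complex^'p^'q \<Rightarrow> complex^'p^('p::finite + 'q::finite)"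
  where "graph_matrix L = (\<chi> i j. case i of Inl k \<Rightarrow> if k = j then 1 else 0 | Inr l \<Rightarrow> L $ l $ j)"

lemma graph_matrix_Inl [simp]: "(graph_matrix L *v v) $ Inl k = v $ k"
  by (simp add: graph_matrix_def matrix_vector_mult_def if_distrib[of "\<lambda>u. u * _"] cong: if_cong)

lemma graph_matrix_Inr [simp]: "(graph_matrix L *v v) $ Inr l = (L *v v) $ l"
  by (simp add: graph_matrix_def matrix_vector_mult_def)

lemma inj_graph_matrix: "inj ((*v) (graph_matrix L))"
proof (rule injI)
  fix u v assume "graph_matrix L *v u = graph_matrix L *v v"
  then have "u $ k = v $ k" for k
    using graph_matrix_Inl[of L u k] graph_matrix_Inl[of L v k] by simp
  then show "u = v"
    by (simp add: vec_eq_iff)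
qed

lemma eq_zero_if_sum_cmod_le_zero:
  fixes v :: "complex^'n::finite"
  assumes "(\<Sum>k\<in>UNIV. (cmod (v $ k))\<^sup>2) \<le> 0"
  shows "v = 0"
proof -
  have "(\<Sum>k\<in>UNIV. (cmod (v $ k))\<^sup>2) = 0"
    using assms by (meson order_antisym sum_nonneg zero_le_power2)
  then show ?thesis
    by (simp add: sum_nonneg_eq_0_iff vec_eq_iff)
qed

text \<open>Extend \<open>a\<close> to a basis of the whole space and span \<open>a\<close> together
  with \<open>r - 1\<close> of the other basis vectors.\<close>

lemma ex_subspace_dim_containing:
  fixes a :: "'a::field^'n"
  assumes "a \<noteq> 0" "1 \<le> r" "r \<le> CARD('n)"
  obtains V where "vec.subspace V" "vec.dim V = r" "a \<in> V"
proof -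
  have "vec.independent {a}"
    using assms(1) by simp
  then obtain B where B: "{a} \<subseteq> B" "vec.independent B" "UNIV \<subseteq> vec.span B"
    by (rule vec.maximal_independent_subset_extend[OF subset_UNIV])
  have finB: "finite B"
    using B(2) vec.finiteI_independent by blast
  have "card B = CARD('n)"
    using vec.dim_unique[OF subset_UNIV B(3) B(2) refl] by (simp add: card_cart_basis vec.dimension_def)
  then have "r - 1 \<le> card (B - {a})"
    using B(1) finB assms(3) by simp
  then obtain C where C: "C \<subseteq> B - {a}" "card C = r - 1" "finite C"
    by (rule obtain_subset_with_card_n)
  have "vec.independent (insert a C)"
    using B(1,2) C(1) by (meson Diff_subset insert_subset subset_trans vec.independent_mono)
  moreover have "card (insert a C) = r"
    using C assms(2) by (subst card_insert_disjoint) auto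
  ultimately show ?thesis
    using that[of "vec.span (insert a C)"] vec.dim_span_eq_card_independent
    by (auto intro: vec.span_base)
qed

text \<open>The plane is taken inside the graph of the rank-one map \<open>v \<mapsto> b \<langle>v, a\<rangle> / |a|\<^sup>2\<close>, where
  \<open>z = (a, b)\<close>: its norm is \<open>|b| / |a| < 1\<close>, so the graph is positive definite.\<close>

lemma positive_vector_in_typeI_domain:
  fixes z :: "complex^('p::finite + 'q::finite)"
  assumes z: "0 < Re (sesq_form Hpq z z)" and r: "1 \<le> r" "r \<le> CARD('p)"
  obtains P where "P \<in> typeI_domain r" "z \<in> P"
proof -
  define a :: "complex^'p" where "a = (\<chi> k. z $ Inl k)"
  define \<alpha> where "\<alpha> = (\<Sum>k\<in>UNIV. (cmod (a $ k))\<^sup>2)"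
  define \<beta> where "\<beta> = (\<Sum>l\<in>UNIV. (cmod (z $ Inr l))\<^sup>2)"
  define L :: "complex^'p^'q" where "L = (\<chi> l k. z $ Inr l * cnj (a $ k) / of_real \<alpha>)"
  have \<alpha>\<beta>: "\<beta> < \<alpha>"
    using z unfolding Re_sesq_form_Hpq \<alpha>_def \<beta>_def a_def by simp
  moreover have "0 \<le> \<beta>"
    unfolding \<beta>_def by (intro sum_nonneg) simp
  ultimately have "0 < \<alpha>"
    by simp
  then have "a \<noteq> 0"
    by (auto simp: \<alpha>_def)
  have L: "(L *v v) $ l = z $ Inr l * (\<Sum>k\<in>UNIV. cnj (a $ k) * v $ k) / of_real \<alpha>" for v l
    by (simp add: L_def matrix_vector_mult_def sum_distrib_left sum_divide_distrib mult_ac)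
  have "(\<Sum>k\<in>UNIV. cnj (a $ k) * a $ k) = of_real \<alpha>"
    unfolding \<alpha>_def of_real_sum complex_norm_square by (simp add: mult.commute)
  then have "(L *v a) $ l = z $ Inr l" for l
    using L[of a l] \<open>0 < \<alpha>\<close> by simp
  then have za: "graph_matrix L *v a = z"
    by (auto simp: vec_eq_iff split_sum_all a_def)
  have posL: "0 < Re (sesq_form Hpq (graph_matrix L *v v) (graph_matrix L *v v))" if "v \<noteq> 0" for v
  proof -
    define \<nu> where "\<nu> = (\<Sum>k\<in>UNIV. (cmod (v $ k))\<^sup>2)"
    have "0 < \<nu>"
      using eq_zero_if_sum_cmod_le_zero[of v] that unfolding \<nu>_def by linarith
    \<comment> \<open>The triangle inequality passes to moduli, so that the real Cauchy-Schwarz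
      inequality applies.\<close>
    have "(cmod (\<Sum>k\<in>UNIV. cnj (a $ k) * v $ k))\<^sup>2 \<le> (\<Sum>k\<in>UNIV. cmod (a $ k) * cmod (v $ k))\<^sup>2"
      by (intro power_mono) (auto intro!: order_trans[OF norm_sum] simp: norm_mult)
    also have "\<dots> \<le> \<alpha> * \<nu>"
      unfolding \<alpha>_def \<nu>_def by (rule Cauchy_Schwarz_ineq_sum)
    finally have CS: "(cmod (\<Sum>k\<in>UNIV. cnj (a $ k) * v $ k))\<^sup>2 \<le> \<alpha> * \<nu>" .
    have "(\<Sum>l\<in>UNIV. (cmod ((L *v v) $ l))\<^sup>2)
        = \<beta> * (cmod (\<Sum>k\<in>UNIV. cnj (a $ k) * v $ k))\<^sup>2 / \<alpha>\<^sup>2"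
      using \<open>0 < \<alpha>\<close>
      by (simp add: L norm_mult norm_divide power_mult_distrib power_divide \<beta>_def
          sum_distrib_right sum_divide_distrib)
    also have "\<dots> \<le> \<beta> * (\<alpha> * \<nu>) / \<alpha>\<^sup>2"
      using CS \<open>0 \<le> \<beta>\<close> by (intro divide_right_mono mult_left_mono) auto
    also have "\<dots> = \<beta> * \<nu> / \<alpha>"
      using \<open>0 < \<alpha>\<close> by (simp add: power2_eq_square)
    also have "\<dots> < \<nu>"
      using \<alpha>\<beta> \<open>0 < \<nu>\<close> \<open>0 < \<alpha>\<close> by (simp add: field_simps)
    finally show ?thesis
      by (simp add: Re_sesq_form_Hpq \<nu>_def)
  qed
  \<comment> \<open>Any \<open>r\<close>-dimensional subspace through \<open>a\<close> will do: the
    graph map is injective, so it preserves the dimension, and it sends \<open>a\<close> to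
    \<open>z\<close>.\<close>
  obtain V where V: "vec.subspace V" "vec.dim V = r" "a \<in> V"
    using ex_subspace_dim_containing[OF \<open>a \<noteq> 0\<close> r] .
  have "vec.subspace ((*v) (graph_matrix L) ` V)"
    using vec.subspace_image[OF V(1)] .
  moreover have "vec.dim ((*v) (graph_matrix L) ` V) = r"
    using vec.dim_image_eq[OF matrix_vector_mul_linear_gen inj_on_subset[OF inj_graph_matrix subset_UNIV]] V(2)
    by metis
  moreover have "pos_def_on Hpq ((*v) (graph_matrix L) ` V)"
    unfolding pos_def_on_def
  proof (intro ballI impI)
    fix w assume "w \<in> (*v) (graph_matrix L) ` V" "w \<noteq> 0"
    then obtain v where "w = graph_matrix L *v v"
      by blast
    then show "0 < Re (sesq_form Hpq w w)"
      using posL[of v] \<open>w \<noteq> 0\<close> by (cases "v = 0") auto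
  qed
  ultimately have "(*v) (graph_matrix L) ` V \<in> typeI_domain r"
    by (simp add: typeI_domain_def)
  then show ?thesis
    using that V(3) za by blast
qed

text \<open>Lower bound: the kernel meets the positive definite coordinate \<open>p\<close>-plane
  only in 0, so \<open>M\<close> is injective on that plane. Upper bound: the projection
  \<open>Q\<close> to the positive coordinates is injective on the range, since a nonzero vector
  killed by \<open>Q\<close> has a negative value of the form.\<close>

lemma rank_eq_if_range_nonneg:
  fixes M :: "complex^('p::finite + 'q::finite)^('p + 'q)"
  assumes ker: "neg_semidef_on Hpq {z. M *v z = 0}"
    and range: "\<And>z. 0 \<le> Re (sesq_form Hpq (M *v z) (M *v z))"
  shows "rank M = CARD('p)"
proof (rule antisym)
  let ?G = "graph_matrix (0 :: complex^'p^'q)"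
  have "inj ((*v) (M ** ?G))"
    unfolding vec.inj_iff_eq_0
  proof (intro allI impI)
    fix v assume "(M ** ?G) *v v = 0"
    then have "Re (sesq_form Hpq (?G *v v) (?G *v v)) \<le> 0"
      using ker by (simp add: neg_semidef_on_def matrix_vector_mul_assoc)
    then show "v = 0"
      by (intro eq_zero_if_sum_cmod_le_zero) (simp add: Re_sesq_form_Hpq)
  qed
  then have "vec.dim (range ((*v) (M ** ?G))) = CARD('p)"
    using vec.dim_image_eq[OF matrix_vector_mul_linear_gen inj_on_subset[OF _ subset_UNIV]]
    by (metis vec_dim_card)
  moreover have "range ((*v) (M ** ?G)) \<subseteq> range ((*v) M)"
    by (auto simp: matrix_vector_mul_assoc[symmetric])
  ultimately show "CARD('p) \<le> rank M"
    unfolding rank_eq_dim_range by (metis vec.dim_subset)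
next
  define Q :: "complex^('p + 'q)^'p" where "Q = (\<chi> k i. if i = Inl k then 1 else 0)"
  have Q: "(Q *v w) $ k = w $ Inl k" for w k
    by (simp add: Q_def matrix_vector_mult_def if_distrib[of "\<lambda>u. u * _"] cong: if_cong)
  have "inj_on ((*v) Q) (range ((*v) M))"
  proof (rule inj_onI)
    fix x y assume "x \<in> range ((*v) M)" "y \<in> range ((*v) M)" and eq: "Q *v x = Q *v y"
    then obtain u v where uv: "x = M *v u" "y = M *v v"
      by blast
    \<comment> \<open>The hypothesis speaks of values of \<open>M\<close>, so the difference of two
      of them is written as one.\<close>
    define w where "w = M *v (u - v)"
    have w: "w = x - y"
      by (simp only: w_def uv matrix_vector_mult_diff_distrib)
    have Inl: "w $ Inl k = 0" for k
      using Q[of x k] Q[of y k] eq by (simp add: w)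
    have "0 \<le> Re (sesq_form Hpq w w)"
      unfolding w_def by (rule range)
    then have "(\<Sum>l\<in>UNIV. (cmod (w $ Inr l))\<^sup>2) \<le> 0"
      unfolding Re_sesq_form_Hpq by (simp add: Inl)
    then have "(\<chi> l. w $ Inr l) = 0"
      by (intro eq_zero_if_sum_cmod_le_zero) simp
    then have "w $ Inr l = 0" for l
      by (simp add: vec_eq_iff)
    then have "w = 0"
      unfolding vec_eq_iff split_sum_all by (simp add: Inl)
    then show "x = y"
      by (simp add: w)
  qed
  \<comment> \<open>Dimension is preserved by a linear map injective on the span, and here the span
    is the range itself.\<close>
  moreover have "vec.span (range ((*v) M)) = range ((*v) M)"
    using vec.subspace_image[OF vec.subspace_UNIV] by (simp add: vec.span_eq_iff)
  ultimately have "vec.dim ((*v) Q ` range ((*v) M)) = vec.dim (range ((*v) M))"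
    using vec.dim_image_eq[OF matrix_vector_mul_linear_gen] by metis
  moreover have "vec.dim ((*v) Q ` range ((*v) M)) \<le> CARD('p)"
    by (rule dim_subset_UNIV_cart_gen)
  ultimately show "rank M \<le> CARD('p)"
    unfolding rank_eq_dim_range by linarith
qed

section \<open>Linear self maps\<close>

text \<open>Passes from planes to vectors, as the S-lemma requires: \<open>z\<close> lies in some
  plane of the domain, whose image is positive definite, and the kernel condition excludes
  \<open>M *v z = 0\<close>.\<close>

lemma represents_maps_positive_vectors:
  fixes M :: "complex^('p::finite + 'q::finite)^('p + 'q)"
  assumes r: "1 \<le> r" "r \<le> CARD('p)"
    and M: "represents r M F" and F: "F \<in> typeI_domain r \<rightarrow> typeI_domain r"
    and z: "0 < Re (sesq_form Hpq z z)"
  shows "0 < Re (sesq_form Hpq (M *v z) (M *v z))"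
proof -
  obtain P where P: "P \<in> typeI_domain r" "z \<in> P"
    using positive_vector_in_typeI_domain[OF z r] .
  have "M *v z \<noteq> 0"
  proof
    assume "M *v z = 0"
    then have "Re (sesq_form Hpq z z) \<le> 0"
      using M by (simp add: represents_def neg_semidef_on_def)
    then show False
      using z by simp
  qed
  moreover have "(*v) M ` P \<in> typeI_domain r"
    using M funcset_mem[OF F P(1)] P(1) by (simp add: represents_def)
  then have "pos_def_on Hpq ((*v) M ` P)"
    by (simp add: typeI_domain_def)
  ultimately show ?thesis
    using P(2) by (auto simp: pos_def_on_def)
qed

text \<open>Permits normalising the multiplier to 1: complex subspaces absorb the nonzero factor
  \<open>k\<close>, so images of planes and the kernel are unchanged.\<close>

lemma represents_scale:
  fixes M N :: "complex^('p::finite + 'q::finite)^('p + 'q)"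
  assumes "k \<noteq> 0" and N: "\<And>z. N *v z = k *s (M *v z)" and M: "represents r M F"
  shows "represents r N F"
proof -
  have "(*v) N ` P = (*v) M ` P" if "vec.subspace P" for P
  proof
    have "N *v z = M *v (k *s z)" for z
      by (simp add: N vector_scalar_commute)
    then show "(*v) N ` P \<subseteq> (*v) M ` P"
      using that by (auto simp: vec.subspace_scale)
    have "M *v z = N *v (inverse k *s z)" for z
      using \<open>k \<noteq> 0\<close> by (simp add: N vector_scalar_commute vector_smult_assoc)
    then show "(*v) M ` P \<subseteq> (*v) N ` P"
      using that by (auto simp: vec.subspace_scale)
  qed
  moreover have "{z. N *v z = 0} = {z. M *v z = 0}"
    using \<open>k \<noteq> 0\<close> by (simp add: N)
  ultimately show ?thesis
    using M by (simp add: represents_def typeI_domain_def)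
qed

theorem theorem2p4:
  fixes r :: nat
    and F :: "(complex^('p::finite + 'q::finite)) set \<Rightarrow> (complex^('p + 'q)) set"
  assumes "1 \<le> r" and "r \<le> CARD('p)"
    and "linear_self_map r F"
    and "\<not> minimal_self_map r F"
  shows "\<exists>M :: complex^('p + 'q)^('p + 'q).
           represents r M F \<and> pos_semidef (M\<^sup>H ** Hpq ** M - Hpq)"
proof -
  from assms(3) obtain M where F: "F \<in> typeI_domain r \<rightarrow> typeI_domain r" and M: "represents r M F"
    by (auto simp: linear_self_map_def)
  \<comment> \<open>The S-lemma needs one positive vector; this one has all positive coordinates 1
    and all others 0.\<close>
  define e :: "complex^('p + 'q)" where "e = graph_matrix 0 *v 1"
  have e: "0 < Re (sesq_form Hpq e e)"
    by (simp add: e_def Re_sesq_form_Hpq)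
  obtain c where c: "0 \<le> c"
    "\<And>z. c * Re (sesq_form Hpq z z) \<le> Re (sesq_form Hpq (M *v z) (M *v z))"
  proof (rule hermitian_S_lemma[OF hermitian_Hpq hermitian_congruence[OF hermitian_Hpq] e])
    show "0 \<le> Re (sesq_form (M\<^sup>H ** Hpq ** M) z z)" if "0 < Re (sesq_form Hpq z z)" for z
      using represents_maps_positive_vectors[OF assms(1,2) M F that]
      by (simp add: sesq_form_congruence)
  qed (simp add: sesq_form_congruence)
  \<comment> \<open>Non-minimality enters here, through the rank.\<close>
  have "c \<noteq> 0"
  proof
    assume "c = 0"
    then have "rank M = CARD('p)"
      using c(2) M by (intro rank_eq_if_range_nonneg) (auto simp: represents_def)
    then show False
      using assms(3,4) M by (auto simp: minimal_self_map_def)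
  qed
  with c(1) have "0 < c"
    by simp
  \<comment> \<open>Scaling by \<open>k\<close> multiplies the form by \<open>inverse c\<close>,
    which turns the multiplier \<open>c\<close> into 1.\<close>
  define k where "k = complex_of_real (inverse (sqrt c))"
  define N where "N = (\<chi> i j. k * M $ i $ j)"
  have N: "N *v z = k *s (M *v z)" for z
    by (simp add: N_def vec_eq_iff matrix_vector_mult_def sum_distrib_left mult.assoc)
  have k: "k \<noteq> 0" "(cmod k)\<^sup>2 = inverse c"
    using \<open>0 < c\<close> by (auto simp: k_def power_inverse norm_inverse)
  have "Re (sesq_form Hpq z z) \<le> Re (sesq_form Hpq (N *v z) (N *v z))" for z
    using c(2)[of z] \<open>0 < c\<close> by (simp add: N sesq_form_scale_self k field_simps)
  then have "pos_semidef (N\<^sup>H ** Hpq ** N - Hpq)"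
    by (simp add: pos_semidef_def hermitian_diff hermitian_congruence hermitian_Hpq
        sesq_form_diff_matrix sesq_form_congruence)
  then show ?thesis
    using represents_scale[OF k(1) N M] by blast
qed

end
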